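(* For all integers $s > r \ge 2$ there exists a constant $n_{r,s}$ such that for all $n \ge n_{r,s}$, $$\mathrm{sat}(n, K_r, K_s) = (n-s+2)\binom{s-2}{r-1} + \binom{s-2}{r}.$$ Moreover, there exists a constant $c_{r,s} > 0$ such that (for all $n \ge n_{r,s}$) the only $n$-vertex $K_s$-saturated graph with at most $\mathrm{sat}(n, K_r, K_s) + c_{r,s} n$ copies of $K_r$ is $K_{s-2} \ast \overline{K}_{n-s+2}$.
   Context: A graph $G$ is $F$-saturated if $G$ contains no subgraph isomorphic to $F$, but adding any edge (between two non-adjacent vertices) to $G$ creates a copy of $F$. For graphs $H,F$, $\mathrm{sat}(n,H,F)$ denotes the minimum number of copies of $H$ in an $n$-vertex $F$-saturated graph. $K_t$ is the complete graph on $t$ vertices and $\overline{K}_t$ the edgeless graph on $t$ vertices. The join $G_1 \ast G_2$ is the disjoint union of $G_1$ and $G_2$ together with all edges between $V(G_1)$ and $V(G_2)$. *)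

theory Defs
  imports Complex_Main
begin

text \<open>A graph is a pair of a vertex set and a set of edges, each edge being a two-element set of
  vertices.\<close>

type_synonym 'a graph = "'a set \<times> 'a set set"

abbreviation verts :: "'a graph \<Rightarrow> 'a set" where
  "verts G \<equiv> fst G"

abbreviation edges :: "'a graph \<Rightarrow> 'a set set" where
  "edges G \<equiv> snd G"

definition simple_graph :: "'a graph \<Rightarrow> bool" where
  "simple_graph G \<longleftrightarrow> finite (verts G) \<and> (\<forall>e\<in>edges G. e \<subseteq> verts G \<and> card e = 2)"

definition graph_iso :: "'a graph \<Rightarrow> 'b graph \<Rightarrow> bool" where
  "graph_iso G H \<longleftrightarrow>
     (\<exists>f. bij_betw f (verts G) (verts H) \<and>
          (\<forall>u\<in>verts G. \<forall>v\<in>verts G. {u, v} \<in> edges G \<longleftrightarrow> {f u, f v} \<in> edges H))"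

definition subgraph :: "'a graph \<Rightarrow> 'a graph \<Rightarrow> bool" where
  "subgraph S G \<longleftrightarrow> simple_graph S \<and> verts S \<subseteq> verts G \<and> edges S \<subseteq> edges G"

definition copies :: "'b graph \<Rightarrow> 'a graph \<Rightarrow> 'a graph set" where
  "copies H G = {S. subgraph S G \<and> graph_iso S H}"

definition add_edge :: "'a \<Rightarrow> 'a \<Rightarrow> 'a graph \<Rightarrow> 'a graph" where
  "add_edge u v G = (verts G, insert {u, v} (edges G))"

definition saturated :: "'b graph \<Rightarrow> 'a graph \<Rightarrow> bool" where
  "saturated F G \<longleftrightarrow>
     copies F G = {} \<and>
     (\<forall>u\<in>verts G. \<forall>v\<in>verts G. u \<noteq> v \<and> {u, v} \<notin> edges G \<longrightarrow> copies F (add_edge u v G) \<noteq> {})"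

text \<open>Every finite graph is isomorphic to one whose vertices are natural numbers, so it suffices to
  minimise over those.  The infimum of a nonempty set of natural numbers is its minimum.\<close>

definition sat :: "nat \<Rightarrow> 'b graph \<Rightarrow> 'c graph \<Rightarrow> nat" where
  "sat n H F =
     Inf {card (copies H G) | G :: nat graph. simple_graph G \<and> card (verts G) = n \<and> saturated F G}"

definition complete_graph :: "nat \<Rightarrow> nat graph" where
  "complete_graph t = ({..<t}, {e. e \<subseteq> {..<t} \<and> card e = 2})"

definition empty_graph :: "nat \<Rightarrow> nat graph" where
  "empty_graph t = ({..<t}, {})"

definition graph_join :: "'a graph \<Rightarrow> 'b graph \<Rightarrow> ('a + 'b) graph" where
  "graph_join G H =
     (verts G <+> verts H,
      (`) Inl ` edges G \<union> (`) Inr ` edges H \<union> {{Inl u, Inr v} | u v. u \<in> verts G \<and> v \<in> verts H})"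

end

theory Submission
  imports Defs
begin

text \<open>Call a clique \<open>K\<^bsub>s-2\<^esub>\<close> inside the neighbourhood of \<open>v\<close> a link of \<open>v\<close>.  If some vertex of a
  \<open>K\<^bsub>s\<^esub>\<close>-saturated graph has exactly one link \<open>Q\<close>, then all its non-neighbours are joined to all of \<open>Q\<close>,
  and this already forces the graph to be \<open>K\<^bsub>s-2\<^esub>\<close> joined to an edgeless graph.

  Otherwise call a vertex light if it lies in at most \<open>D\<close> copies of \<open>K\<^bsub>r\<^esub>\<close>, for a large constant \<open>D\<close>.
  A light vertex has boundedly many links, and they cover its non-neighbours, so unless it is adjacent
  to almost everything one of its links has many common neighbours and hence consists of heavy
  vertices.  That link gives \<open>(s-2) choose (r-1)\<close> copies of \<open>K\<^bsub>r\<^esub>\<close> whose only light vertex is \<open>v\<close>, and a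
  second link gives a further copy, which is shared by at most \<open>r\<close> vertices.  As only few vertices are
  heavy or adjacent to almost everything, there are at least \<open>((s-2) choose (r-1) + 1/(2r)) n - O(1)\<close>
  copies of \<open>K\<^bsub>r\<^esub>\<close>.\<close>

section \<open>Copies of complete graphs as cliques\<close>

definition cliques :: "nat \<Rightarrow> 'a graph \<Rightarrow> 'a set set" where
  "cliques k G = {X. X \<subseteq> verts G \<and> card X = k \<and> (\<forall>u\<in>X. \<forall>v\<in>X. u \<noteq> v \<longrightarrow> {u, v} \<in> edges G)}"

definition nbrs :: "'a graph \<Rightarrow> 'a \<Rightarrow> 'a set" where
  "nbrs G v = {u \<in> verts G. {u, v} \<in> edges G}"

lemma edge_distinct: "simple_graph G \<Longrightarrow> {u, v} \<in> edges G \<Longrightarrow> u \<noteq> v"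
  unfolding simple_graph_def by (cases "u = v") auto

lemma edge_verts: "simple_graph G \<Longrightarrow> {u, v} \<in> edges G \<Longrightarrow> u \<in> verts G \<and> v \<in> verts G"
  unfolding simple_graph_def by blast

lemma finite_cliques [simp]: "simple_graph G \<Longrightarrow> finite (cliques k G)"
  by (rule finite_subset[of _ "Pow (verts G)"]) (auto simp: cliques_def simple_graph_def)

lemma finite_clique: "simple_graph G \<Longrightarrow> X \<in> cliques k G \<Longrightarrow> finite X"
  by (auto simp: cliques_def simple_graph_def intro: finite_subset)

lemma cliques_mono: "X \<in> cliques k G \<Longrightarrow> Y \<subseteq> X \<Longrightarrow> card Y = m \<Longrightarrow> Y \<in> cliques m G"
  unfolding cliques_def by blast

lemma insert_clique:
  assumes "simple_graph G" "X \<in> cliques k G" "v \<in> verts G" "X \<subseteq> nbrs G v"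
  shows "insert v X \<in> cliques (Suc k) G" and "v \<notin> X"
proof -
  show v: "v \<notin> X"
    using assms edge_distinct[OF assms(1)] by (auto simp: nbrs_def)
  show "insert v X \<in> cliques (Suc k) G"
    using assms v finite_clique[OF assms(1,2)]
    by (auto simp: cliques_def nbrs_def insert_commute)
qed

text \<open>An isomorphism to a complete graph forces every pair of distinct vertices to be an edge,
  so a copy is determined by its vertex set. From here on copies are counted as vertex sets.\<close>

lemma bij_betw_copies_cliques:
  assumes "simple_graph G"
  shows "bij_betw fst (copies (complete_graph r) G) (cliques r G)"
proof (rule bij_betwI')
  have edges_eq: "edges S = {e. e \<subseteq> verts S \<and> card e = 2}"
    if "S \<in> copies (complete_graph r) G" for S
  proof -
    from that obtain f where f: "bij_betw f (verts S) {..<r}"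
      "\<forall>u\<in>verts S. \<forall>v\<in>verts S. {u, v} \<in> edges S \<longleftrightarrow> {f u, f v} \<in> edges (complete_graph r)"
      and S: "simple_graph S"
      by (auto simp: copies_def subgraph_def graph_iso_def complete_graph_def)
    have "{u, v} \<in> edges S" if "u \<in> verts S" "v \<in> verts S" "u \<noteq> v" for u v
    proof -
      have "f u \<noteq> f v" "f u < r" "f v < r"
        using that f(1) by (auto simp: bij_betw_def inj_on_def)
      then show ?thesis using f(2) that by (auto simp: complete_graph_def)
    qed
    then show ?thesis using S by (auto simp: simple_graph_def card_2_iff)
  qed
  show "fst S = fst T \<longleftrightarrow> S = T"
    if "S \<in> copies (complete_graph r) G" "T \<in> copies (complete_graph r) G" for S T
    using edges_eq[OF that(1)] edges_eq[OF that(2)] by (auto simp: prod_eq_iff)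
  show "fst S \<in> cliques r G" if S: "S \<in> copies (complete_graph r) G" for S
  proof -
    from S obtain f where "bij_betw f (verts S) {..<r}"
      by (auto simp: copies_def graph_iso_def complete_graph_def)
    then have "card (verts S) = r" using bij_betw_same_card by fastforce
    then show ?thesis using S edges_eq[OF S]
      by (auto simp: cliques_def copies_def subgraph_def)
  qed
  show "\<exists>S\<in>copies (complete_graph r) G. X = fst S" if X: "X \<in> cliques r G" for X
  proof
    let ?S = "(X, {e. e \<subseteq> X \<and> card e = 2})"
    have fin: "finite X" using X assms finite_clique by blast
    then obtain f where f: "bij_betw f X {..<r}"
      using X by (auto simp: cliques_def lessThan_atLeast0 dest: ex_bij_betw_finite_nat)
    have "{u, v} \<in> edges ?S \<longleftrightarrow> {f u, f v} \<in> edges (complete_graph r)"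
      if "u \<in> X" "v \<in> X" for u v
    proof -
      have "f u = f v \<longleftrightarrow> u = v" "f u < r" "f v < r"
        using that f by (auto simp: bij_betw_def inj_on_def)
      then show ?thesis using that by (auto simp: complete_graph_def card_insert_if)
    qed
    then have "graph_iso ?S (complete_graph r)"
      using f by (auto simp: graph_iso_def complete_graph_def)
    moreover have "subgraph ?S G"
      using X fin by (auto simp: subgraph_def simple_graph_def cliques_def card_2_iff)
    ultimately show "?S \<in> copies (complete_graph r) G" by (simp add: copies_def)
  qed simp
qed

lemma card_copies_complete_graph:
  "simple_graph G \<Longrightarrow> card (copies (complete_graph r) G) = card (cliques r G)"
  by (rule bij_betw_same_card[OF bij_betw_copies_cliques])

lemma copies_complete_graph_empty_iff:
  "simple_graph G \<Longrightarrow> copies (complete_graph r) G = {} \<longleftrightarrow> cliques r G = {}"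
  using bij_betw_copies_cliques[of G r] by (auto simp: bij_betw_def)

section \<open>Saturation in terms of cliques\<close>

lemma simple_graph_add_edge:
  "simple_graph G \<Longrightarrow> u \<in> verts G \<Longrightarrow> v \<in> verts G \<Longrightarrow> u \<noteq> v \<Longrightarrow> simple_graph (add_edge u v G)"
  by (auto simp: simple_graph_def add_edge_def)

text \<open>As \<open>G\<close> has no \<open>s\<close>-clique, one created by the new edge contains
  both \<open>u\<close> and \<open>v\<close>; removing them leaves a clique in the common
  neighbourhood, and the step can be reversed.\<close>

lemma cliques_add_edge_iff:
  assumes G: "simple_graph G" and s: "2 \<le> s" and free: "cliques s G = {}"
    and uv: "u \<in> verts G" "v \<in> verts G" "u \<noteq> v" "{u, v} \<notin> edges G"
  shows "cliques s (add_edge u v G) \<noteq> {} \<longleftrightarrow> (\<exists>P\<in>cliques (s - 2) G. P \<subseteq> nbrs G u \<inter> nbrs G v)"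
proof
  assume "cliques s (add_edge u v G) \<noteq> {}"
  then obtain X where X: "X \<in> cliques s (add_edge u v G)" by blast
  have fin: "finite X" using X finite_clique simple_graph_add_edge[OF G uv(1-3)] by blast
  have uvX: "u \<in> X \<and> v \<in> X"
  proof (rule ccontr)
    assume "\<not> ?thesis"
    then have "X \<in> cliques s G" using X by (auto simp: cliques_def add_edge_def doubleton_eq_iff)
    with free show False by blast
  qed
  have "X - {u, v} \<in> cliques (s - 2) G"
    using X fin uv uvX by (auto simp: cliques_def add_edge_def doubleton_eq_iff)
  moreover have "X - {u, v} \<subseteq> nbrs G u \<inter> nbrs G v"
    using X uvX by (auto simp: cliques_def add_edge_def doubleton_eq_iff nbrs_def)
  ultimately show "\<exists>P\<in>cliques (s - 2) G. P \<subseteq> nbrs G u \<inter> nbrs G v" by blast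
next
  assume "\<exists>P\<in>cliques (s - 2) G. P \<subseteq> nbrs G u \<inter> nbrs G v"
  then obtain P where P: "P \<in> cliques (s - 2) G" "P \<subseteq> nbrs G u" "P \<subseteq> nbrs G v" by blast
  have notin: "u \<notin> P" "v \<notin> P" using insert_clique[OF G P(1)] P uv by blast+
  have "insert u (insert v P) \<in> cliques s (add_edge u v G)"
    using P notin uv s finite_clique[OF G P(1)]
    by (auto simp: cliques_def add_edge_def nbrs_def insert_commute)
  then show "cliques s (add_edge u v G) \<noteq> {}" by blast
qed

text \<open>For \<open>s\<close> at least 2 this is saturation for the complete graph on
  \<open>s\<close> vertices, stated inside \<open>G\<close> alone without the operation of adding an
  edge.\<close>

locale clique_saturated_graph =
  fixes G :: "'a graph" and s :: nat
  assumes simple: "simple_graph G"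
    and free: "cliques s G = {}"
    and common_clique: "\<lbrakk>u \<in> verts G; v \<in> verts G; u \<noteq> v; {u, v} \<notin> edges G\<rbrakk>
      \<Longrightarrow> \<exists>P\<in>cliques (s - 2) G. P \<subseteq> nbrs G u \<inter> nbrs G v"

lemma saturated_complete_graph_iff:
  assumes G: "simple_graph G" and s: "2 \<le> s"
  shows "saturated (complete_graph s) G \<longleftrightarrow> clique_saturated_graph G s"
proof -
  have "saturated (complete_graph s) G \<longleftrightarrow> cliques s G = {} \<and>
     (\<forall>u\<in>verts G. \<forall>v\<in>verts G. u \<noteq> v \<and> {u, v} \<notin> edges G \<longrightarrow> cliques s (add_edge u v G) \<noteq> {})"
    unfolding saturated_def
    by (auto simp: copies_complete_graph_empty_iff[OF G]
        copies_complete_graph_empty_iff[OF simple_graph_add_edge[OF G]])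
  also have "\<dots> \<longleftrightarrow> clique_saturated_graph G s"
    unfolding clique_saturated_graph_def using cliques_add_edge_iff[OF G s] G by auto
  finally show ?thesis .
qed

section \<open>Vertices with a unique link\<close>

text \<open>This is the join of a complete graph on \<open>Q\<close> with an edgeless graph on the
  other vertices, recognised inside \<open>G\<close> without naming an isomorphism.\<close>

definition split_graph :: "'a graph \<Rightarrow> 'a set \<Rightarrow> bool" where
  "split_graph G Q \<longleftrightarrow> Q \<subseteq> verts G \<and>
     (\<forall>u\<in>verts G. \<forall>v\<in>verts G. {u, v} \<in> edges G \<longleftrightarrow> u \<noteq> v \<and> (u \<in> Q \<or> v \<in> Q))"

context clique_saturated_graph
begin

lemma finite_verts: "finite (verts G)" using simple by (simp add: simple_graph_def)

definition link :: "'a \<Rightarrow> 'a set set" where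
  "link v = {P \<in> cliques (s - 2) G. P \<subseteq> nbrs G v}"

lemma finite_link: "finite (link v)" using finite_cliques[OF simple] by (simp add: link_def)

text \<open>The vertices joined to all of \<open>Q\<close> form an independent set \<open>I\<close>
  that contains every non-neighbour of \<open>v\<close>. A vertex outside both \<open>I\<close> and
  \<open>Q\<close> could be exchanged into a second link of \<open>v\<close>, so only
  \<open>Q\<close> remains outside \<open>I\<close>.\<close>

lemma unique_link_imp_split:
  assumes s: "3 \<le> s" and v: "v \<in> verts G" and uniq: "link v = {Q}"
  shows "split_graph G Q" and "card Q = s - 2"
proof -
  have Q: "Q \<in> cliques (s - 2) G" "Q \<subseteq> nbrs G v" using uniq by (auto simp: link_def)
  show "card Q = s - 2" using Q by (simp add: cliques_def)
  define I where "I = {u \<in> verts G. Q \<subseteq> nbrs G u}"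
  \<comment> \<open>Otherwise \<open>P\<close> together with \<open>x\<close> and \<open>y\<close>
    would be a clique on \<open>s\<close> vertices.\<close>
  have too_big: False if "P \<in> cliques (s - 2) G" "P \<subseteq> nbrs G x" "P \<subseteq> nbrs G y"
    "{x, y} \<in> edges G" for P x y
  proof -
    have xy: "x \<in> verts G" "y \<in> verts G" using edge_verts[OF simple that(4)] by auto
    have "insert y P \<in> cliques (Suc (s - 2)) G" using insert_clique[OF simple that(1)] that xy by blast
    moreover have "insert y P \<subseteq> nbrs G x"
      using that xy by (auto simp: nbrs_def insert_commute)
    ultimately have "insert x (insert y P) \<in> cliques (Suc (Suc (s - 2))) G"
      using insert_clique[OF simple] xy by blast
    moreover have "Suc (Suc (s - 2)) = s" using s by simp
    ultimately show False using free by simp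
  qed
  have indep: "{x, y} \<notin> edges G" if "x \<in> I" "y \<in> I" for x y
    using too_big[OF Q(1)] that by (auto simp: I_def)
  have vI: "v \<in> I" using v Q by (simp add: I_def)
  have nonadj: "u \<in> I" if "u \<in> verts G" "{v, u} \<notin> edges G" for u
  proof (cases "u = v")
    case False
    then obtain P where "P \<in> cliques (s - 2) G" "P \<subseteq> nbrs G v \<inter> nbrs G u"
      using common_clique[OF v] \<open>u \<in> verts G\<close> \<open>{v, u} \<notin> edges G\<close> by blast
    moreover from this have "P = Q" using uniq by (auto simp: link_def)
    ultimately show ?thesis using that by (simp add: I_def)
  qed (use vI in simp)
  have nv: "nbrs G v = verts G - I"
    using nonadj indep[OF vI] by (auto simp: nbrs_def insert_commute)
  have B: "b \<in> Q" if b: "b \<in> verts G" "b \<notin> I" for b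
  proof (rule ccontr)
    assume bQ: "b \<notin> Q"
    obtain q where q: "q \<in> Q" "q \<notin> nbrs G b" using b by (auto simp: I_def)
    have qV: "q \<in> verts G" using q Q by (auto simp: cliques_def)
    have "{b, q} \<notin> edges G" "b \<noteq> q" using q qV bQ by (auto simp: nbrs_def insert_commute)
    then obtain P where P: "P \<in> cliques (s - 2) G" "P \<subseteq> nbrs G b" "P \<subseteq> nbrs G q"
      using common_clique b qV by blast
    have bv: "{v, b} \<in> edges G" using b nonadj by blast
    \<comment> \<open>The clique \<open>P\<close> must leave the neighbourhood of \<open>v\<close>,
      so it meets \<open>I\<close>, and by independence in a single vertex \<open>w\<close>.
      Exchanging \<open>w\<close> for \<open>b\<close> gives a link of \<open>v\<close> that
      contains \<open>b\<close>, hence differs from \<open>Q\<close>.\<close>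
    have "\<not> P \<subseteq> nbrs G v" using too_big[OF P(1)] P(2) bv by blast
    then obtain w where w: "w \<in> P" "w \<in> I" using P nv by (auto simp: cliques_def)
    have PI: "P - {w} \<subseteq> nbrs G v"
      using w P(1) indep unfolding nv cliques_def by blast
    have fP: "finite P" using finite_clique[OF simple P(1)] .
    have "P - {w} \<in> cliques (s - 3) G"
      using P(1) fP w by (intro cliques_mono[OF P(1)]) (auto simp: cliques_def)
    then have "insert b (P - {w}) \<in> cliques (Suc (s - 3)) G"
      using insert_clique[OF simple] P b by blast
    moreover have "Suc (s - 3) = s - 2" using s by simp
    moreover have "insert b (P - {w}) \<subseteq> nbrs G v" using PI b nv by simp
    ultimately have "insert b (P - {w}) \<in> link v" by (simp add: link_def)
    then show False using uniq bQ by auto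
  qed
  have "{x, y} \<in> edges G \<longleftrightarrow> x \<noteq> y \<and> (x \<in> Q \<or> y \<in> Q)" if "x \<in> verts G" "y \<in> verts G" for x y
  proof
    assume e: "{x, y} \<in> edges G"
    then show "x \<noteq> y \<and> (x \<in> Q \<or> y \<in> Q)" using B indep that edge_distinct[OF simple e] by blast
  next
    have *: "{x, y} \<in> edges G" if "x \<in> Q" "y \<in> verts G" "x \<noteq> y" for x y
      using that B Q(1) by (cases "y \<in> I") (auto simp: I_def nbrs_def cliques_def)
    assume "x \<noteq> y \<and> (x \<in> Q \<or> y \<in> Q)"
    then show "{x, y} \<in> edges G" using *[of x y] *[of y x] that by (auto simp: insert_commute)
  qed
  then show "split_graph G Q" using Q by (auto simp: split_graph_def cliques_def)
qed

end

section \<open>Counting cliques at light vertices\<close>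

context clique_saturated_graph
begin

definition through :: "nat \<Rightarrow> 'a \<Rightarrow> 'a set set" where
  "through r v = {X \<in> cliques r G. v \<in> X}"

lemma finite_through: "finite (through r v)"
  using finite_cliques[OF simple] by (simp add: through_def)

text \<open>Choosing a vertex of \<open>Y\<close> and passing to its neighbours discards at most
  \<open>K\<close> vertices, the chosen one included, so \<open>j * K\<close> vertices suffice for
  \<open>j\<close> choices.\<close>

lemma greedy_clique:
  assumes "0 < K"
  shows "Y \<subseteq> verts G \<Longrightarrow> (\<And>v. v \<in> Y \<Longrightarrow> card (verts G - nbrs G v) \<le> K) \<Longrightarrow> j * K \<le> card Y
    \<Longrightarrow> \<exists>X\<in>cliques j G. X \<subseteq> Y"
proof (induction j arbitrary: Y)
  case 0
  show ?case by (rule bexI[of _ "{}"]) (auto simp: cliques_def)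
next
  case (Suc j)
  have "card Y \<noteq> 0" using Suc.prems(3) assms by auto
  then obtain y where y: "y \<in> Y" by fastforce
  have finY: "finite Y" using Suc.prems(1) finite_verts finite_subset by blast
  let ?Y = "Y \<inter> nbrs G y"
  have "card Y \<le> card (?Y \<union> (verts G - nbrs G y))"
    using Suc.prems(1) finY finite_verts by (intro card_mono) auto
  also have "\<dots> \<le> card ?Y + card (verts G - nbrs G y)" by (rule card_Un_le)
  also have "\<dots> \<le> card ?Y + K" using Suc.prems(2)[OF y] by simp
  finally have "j * K \<le> card ?Y" using Suc.prems(3) by simp
  with Suc.IH[of ?Y] Suc.prems obtain X where X: "X \<in> cliques j G" "X \<subseteq> ?Y" by blast
  then have "insert y X \<in> cliques (Suc j) G"
    using insert_clique[OF simple X(1)] y Suc.prems(1) by blast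
  then show ?case using X y by blast
qed

text \<open>More such vertices would contain an \<open>s\<close>-clique by the greedy argument.
  These are the vertices with too few non-neighbours for \<open>ex_heavy_link\<close>.\<close>

lemma few_almost_conical:
  assumes "0 < K"
  shows "card {v \<in> verts G. card (verts G - nbrs G v) \<le> K} \<le> s * K"
proof (rule ccontr)
  assume "\<not> ?thesis"
  then have "\<exists>X\<in>cliques s G. X \<subseteq> {v \<in> verts G. card (verts G - nbrs G v) \<le> K}"
    by (intro greedy_clique[OF assms]) auto
  with free show False by blast
qed

lemma link_finite_card:
  assumes "P \<in> link v"
  shows "finite P" and "card P = s - 2"
proof -
  have P: "P \<in> cliques (s - 2) G" using assms by (simp add: link_def)
  show "finite P" using finite_clique[OF simple P] .
  show "card P = s - 2" using P by (simp add: cliques_def)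
qed

text \<open>The bounds on \<open>r\<close> give \<open>1 \<le> r - 1 \<le> s - 2\<close>, so a
  subset of the required size can be chosen around \<open>p\<close>.\<close>

lemma link_subset:
  assumes "P \<in> link v" "p \<in> P" "2 \<le> r" "r < s"
  obtains R where "R \<subseteq> P" "p \<in> R" "card R = r - 1"
proof -
  have "finite P" "card P = s - 2"
    using link_finite_card[OF assms(1)] by auto
  then have "\<exists>R. {p} \<subseteq> R \<and> R \<subseteq> P \<and> card R = r - 1"
    using assms by (intro exists_subset_between) auto
  then show ?thesis using that by blast
qed

lemma insert_link_through:
  assumes v: "v \<in> verts G" and P: "P \<in> link v" and R: "R \<subseteq> P" "card R = r - 1" and r: "1 \<le> r"
  shows "insert v R \<in> through r v" and "v \<notin> P"
proof -
  have P': "P \<in> cliques (s - 2) G" "P \<subseteq> nbrs G v" using P by (auto simp: link_def)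
  show "v \<notin> P" using insert_clique(2)[OF simple P'(1) v P'(2)] .
  have "R \<in> cliques (r - 1) G" using cliques_mono P' R by blast
  then have "insert v R \<in> cliques (Suc (r - 1)) G"
    using insert_clique(1)[OF simple _ v] P' R by blast
  then show "insert v R \<in> through r v" using r by (simp add: through_def)
qed

text \<open>Each vertex of a link shares an \<open>r\<close>-clique with \<open>v\<close>. Hence all
  links are subsets of the union of at most \<open>D\<close> cliques of size \<open>r\<close>, a set
  of at most \<open>r * D\<close> vertices.\<close>

lemma card_link_le:
  assumes v: "v \<in> verts G" and r: "2 \<le> r" "r < s" and D: "card (through r v) \<le> D"
  shows "card (link v) \<le> 2 ^ (r * D)"
proof -
  let ?U = "\<Union>(through r v)"
  have fin: "finite ?U"
    using finite_through finite_clique[OF simple] by (auto simp: through_def)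
  have "p \<in> ?U" if P: "P \<in> link v" "p \<in> P" for P p
  proof -
    obtain R where "R \<subseteq> P" "p \<in> R" "card R = r - 1" using link_subset[OF P r] .
    then show ?thesis using insert_link_through(1)[OF v P(1), of R r] r by auto
  qed
  then have "link v \<subseteq> Pow ?U" by blast
  then have "card (link v) \<le> card (Pow ?U)" using fin by (intro card_mono) auto
  also have "\<dots> = 2 ^ card ?U" using fin by (rule card_Pow)
  also have "card ?U \<le> (\<Sum>X\<in>through r v. card X)" by (rule card_Union_le_sum_card)
  also have "\<dots> = (\<Sum>X\<in>through r v. r)"
    by (rule sum.cong) (auto simp: through_def cliques_def)
  also have "\<dots> \<le> r * D" using D by simp
  finally show ?thesis by (simp add: power_increasing)
qed

text \<open>All non-neighbours of \<open>v\<close> are distributed among the boundedly many members of \<open>link v\<close>, so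
  one of these has many common neighbours.\<close>

lemma ex_heavy_link:
  assumes v: "v \<in> verts G" and r: "2 \<le> r" "r < s" and D: "card (through r v) \<le> D"
    and K: "D * 2 ^ (r * D) + 1 < card (verts G - nbrs G v)"
  shows "\<exists>Q\<in>link v. \<forall>q\<in>Q. D < card (through r q)"
proof -
  define W where "W Q = {w \<in> verts G. Q \<subseteq> nbrs G w}" for Q
  have fW: "finite (W Q)" for Q using finite_verts by (simp add: W_def)
  have "\<exists>Q\<in>link v. D < card (W Q)"
  proof (rule ccontr)
    assume "\<not> ?thesis"
    then have le: "card (W Q) \<le> D" if "Q \<in> link v" for Q using that by (meson not_less)
    \<comment> \<open>The vertex \<open>v\<close> counts among its own non-neighbours but is not
      reached through \<open>common_clique\<close>; this accounts for the additive \<open>1\<close>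
      in hypothesis \<open>K\<close>.\<close>
    have "verts G - nbrs G v \<subseteq> insert v (\<Union>Q\<in>link v. W Q)"
    proof
      fix w assume w: "w \<in> verts G - nbrs G v"
      show "w \<in> insert v (\<Union>Q\<in>link v. W Q)"
      proof (cases "w = v")
        case False
        then obtain P where "P \<in> cliques (s - 2) G" "P \<subseteq> nbrs G w \<inter> nbrs G v"
          using common_clique[of w v] w v by (auto simp: nbrs_def)
        then show ?thesis using w by (auto simp: link_def W_def)
      qed simp
    qed
    then have "card (verts G - nbrs G v) \<le> card (insert v (\<Union>Q\<in>link v. W Q))"
      using fW finite_link by (intro card_mono) auto
    also have "\<dots> \<le> Suc (card (\<Union>Q\<in>link v. W Q))" by (rule card_insert_le_m1) auto
    also have "card (\<Union>Q\<in>link v. W Q) \<le> (\<Sum>Q\<in>link v. card (W Q))"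
      by (rule card_UN_le[OF finite_link])
    also have "\<dots> \<le> (\<Sum>Q\<in>link v. D)" by (rule sum_mono) (rule le)
    also have "\<dots> \<le> D * 2 ^ (r * D)" using card_link_le[OF v r D] by simp
    finally show False using K by simp
  qed
  then obtain Q where Q: "Q \<in> link v" "D < card (W Q)" by blast
  have "D < card (through r q)" if q: "q \<in> Q" for q
  proof -
    obtain R where R: "R \<subseteq> Q" "q \<in> R" "card R = r - 1" using link_subset[OF Q(1) q r] .
    have W: "w \<in> verts G \<and> Q \<in> link w" if "w \<in> W Q" for w
      using that Q by (auto simp: W_def link_def)
    have "w \<notin> R" if "w \<in> W Q" for w
      using insert_link_through(2)[of w Q R r] W[OF that] R r by auto
    \<comment> \<open>With \<open>R\<close> containing \<open>q\<close> fixed, distinct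
      \<open>w\<close> in \<open>W Q\<close> give distinct \<open>r\<close>-cliques through
      \<open>q\<close>, so \<open>q\<close> lies in more than \<open>D\<close> of them.\<close>
    then have inj: "inj_on (\<lambda>w. insert w R) (W Q)" by (auto simp: inj_on_def)
    have "insert w R \<in> through r q" if "w \<in> W Q" for w
      using insert_link_through(1)[of w Q R r] W[OF that] R r by (auto simp: through_def)
    then have "card (W Q) \<le> card (through r q)"
      by (intro card_inj_on_le[OF inj]) (auto simp: finite_through)
    then show ?thesis using Q by simp
  qed
  then show ?thesis using Q by blast
qed

text \<open>An \<open>r\<close>-clique is worth \<open>r\<close> if all but one of its vertices lie in \<open>S\<close>, and each of its vertices
  in \<open>T\<close> earns \<open>1\<close> otherwise, so that no clique is counted more than \<open>r\<close> times.\<close>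

lemma weighted_clique_count:
  assumes r: "2 \<le> r" "r < s" and T: "T \<subseteq> verts G" "S \<inter> T = {}"
    and two: "\<And>v. v \<in> T \<Longrightarrow> \<exists>Q\<in>link v. Q \<subseteq> S \<and> link v \<noteq> {Q}"
  shows "card T * (r * ((s - 2) choose (r - 1)) + 1) \<le> r * card (cliques r G)"
proof -
  define wt where "wt v X = (if X - {v} \<subseteq> S then r else 1)" for v X
  have finT: "finite T" using T finite_verts finite_subset by blast
  \<comment> \<open>The subsets of the link inside \<open>S\<close> yield cliques of weight
    \<open>r\<close>; a second link supplies one more clique, of weight at least 1.\<close>
  have lower: "r * ((s - 2) choose (r - 1)) + 1 \<le> (\<Sum>X\<in>through r v. wt v X)" if v: "v \<in> T" for v
  proof -
    obtain Q Q' where Q: "Q \<in> link v" "Q \<subseteq> S" and Q': "Q' \<in> link v" "Q' \<noteq> Q"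
      using two[OF v] by blast
    have vV: "v \<in> verts G" using v T by blast
    have card: "card Q = s - 2" "card Q' = s - 2" "finite Q" "finite Q'"
      using link_finite_card[OF Q(1)] link_finite_card[OF Q'(1)] by auto
    \<comment> \<open>Both links have \<open>s - 2\<close> elements, so neither contains the other.
      A clique through \<open>q\<close> cannot arise from \<open>Q\<close>.\<close>
    obtain q where q: "q \<in> Q'" "q \<notin> Q"
      using card Q'(2) card_subset_eq[of Q Q'] by auto
    obtain R where R: "R \<subseteq> Q'" "q \<in> R" "card R = r - 1" using link_subset[OF Q'(1) q(1) r] .
    define \<R> where "\<R> = {R. R \<subseteq> Q \<and> card R = r - 1}"
    have fin\<R>: "finite \<R>" using card by (simp add: \<R>_def)
    \<comment> \<open>Only the second conclusion of the lemma is wanted; for \<open>Q\<close> the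
      trivial instance with the empty subset and \<open>r = 1\<close> delivers it.\<close>
    have vQ: "v \<notin> Q" "v \<notin> Q'"
      using insert_link_through(2)[OF vV Q'(1) R(1,3)] r
        insert_link_through(2)[OF vV Q(1), of "{}" 1] by auto
    have "card (insert v ` \<R>) = card \<R>"
      using vQ by (intro card_image) (auto simp: inj_on_def \<R>_def)
    also have "\<dots> = (s - 2) choose (r - 1)" using n_subsets[of Q "r - 1"] card by (simp add: \<R>_def)
    finally have c: "card (insert v ` \<R>) = (s - 2) choose (r - 1)" .
    have new: "insert v R \<notin> insert v ` \<R>" using R q vQ by (auto simp: \<R>_def)
    have "r * ((s - 2) choose (r - 1)) + 1 = (\<Sum>X\<in>insert v ` \<R>. r) + 1" using c by simp
    also have "\<dots> \<le> (\<Sum>X\<in>insert v ` \<R>. wt v X) + wt v (insert v R)"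
      using Q r by (intro add_mono sum_mono) (auto simp: wt_def \<R>_def)
    also have "\<dots> = (\<Sum>X\<in>insert (insert v R) (insert v ` \<R>). wt v X)"
      using new fin\<R> by simp
    also have "\<dots> \<le> (\<Sum>X\<in>through r v. wt v X)"
    proof (rule sum_mono2[OF finite_through])
      show "insert (insert v R) (insert v ` \<R>) \<subseteq> through r v"
        using insert_link_through(1)[OF vV Q(1)] insert_link_through(1)[OF vV Q'(1) R(1,3)] r
        by (auto simp: \<R>_def)
    qed simp
    finally show ?thesis .
  qed
  have upper: "(\<Sum>v\<in>{v \<in> T. v \<in> X}. wt v X) \<le> r" if X: "X \<in> cliques r G" for X
  proof (cases "\<exists>v\<in>T. v \<in> X \<and> X - {v} \<subseteq> S")
    \<comment> \<open>As \<open>S\<close> and \<open>T\<close> are disjoint, \<open>v\<close> is the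
      only vertex of \<open>T\<close> in \<open>X\<close>, so the weight \<open>r\<close> is paid
      once.\<close>
    case True
    then obtain v where "v \<in> T" "v \<in> X" "X - {v} \<subseteq> S" by blast
    moreover from this have "{v \<in> T. v \<in> X} = {v}" using T by blast
    ultimately show ?thesis by (simp add: wt_def)
  next
    case False
    then have "(\<Sum>v\<in>{v \<in> T. v \<in> X}. wt v X) = card {v \<in> T. v \<in> X}"
      by (subst card_eq_sum, intro sum.cong) (auto simp: wt_def)
    also have "\<dots> \<le> card X" using finite_clique[OF simple X] by (intro card_mono) auto
    finally show ?thesis using X by (simp add: cliques_def)
  qed
  have "card T * (r * ((s - 2) choose (r - 1)) + 1) \<le> (\<Sum>v\<in>T. \<Sum>X\<in>through r v. wt v X)"
    using sum_bounded_below[of T "r * ((s - 2) choose (r - 1)) + 1"] lower by simp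
  also have "\<dots> = (\<Sum>X\<in>cliques r G. \<Sum>v\<in>{v \<in> T. v \<in> X}. wt v X)"
    unfolding through_def using finT finite_cliques[OF simple] by (rule sum.swap_restrict)
  also have "\<dots> \<le> (\<Sum>X\<in>cliques r G. r)" by (rule sum_mono) (rule upper)
  finally show ?thesis by (simp add: mult.commute)
qed

text \<open>Double counting of incidences between vertices and \<open>r\<close>-cliques; it serves
  to bound the number of heavy vertices.\<close>

lemma sum_card_through: "(\<Sum>v\<in>verts G. card (through r v)) = r * card (cliques r G)"
proof -
  have "(\<Sum>v\<in>verts G. card (through r v)) = (\<Sum>v\<in>verts G. \<Sum>X\<in>{X \<in> cliques r G. v \<in> X}. 1)"
    by (simp add: through_def)
  also have "\<dots> = (\<Sum>X\<in>cliques r G. \<Sum>v\<in>{v \<in> verts G. v \<in> X}. 1)"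
    using finite_verts finite_cliques[OF simple] by (rule sum.swap_restrict)
  also have "\<dots> = (\<Sum>X\<in>cliques r G. r)"
  proof (rule sum.cong)
    fix X assume "X \<in> cliques r G"
    moreover from this have "{v \<in> verts G. v \<in> X} = X" by (auto simp: cliques_def)
    ultimately show "(\<Sum>v\<in>{v \<in> verts G. v \<in> X}. 1) = r" by (simp add: cliques_def)
  qed simp
  finally show ?thesis by (simp add: mult.commute)
qed

end

text \<open>This is the lower bound \<open>(b + 1/(2r)) n - O(1)\<close> on the number of
  \<open>r\<close>-cliques, multiplied by \<open>2 * r\<close> and rearranged to stay within the
  natural numbers. The constant \<open>M\<close> is fixed before \<open>G\<close>.\<close>

lemma many_cliques_unless_split:
  assumes r: "2 \<le> r" "r < s"
  obtains M where "\<And>G :: 'a graph. clique_saturated_graph G s \<Longrightarrow>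
    \<not> (\<exists>Q. split_graph G Q \<and> card Q = s - 2) \<Longrightarrow>
    2 * r * ((s - 2) choose (r - 1)) * card (verts G) + card (verts G) \<le> 2 * r * card (cliques r G) + M"
proof
  define b where "b = (s - 2) choose (r - 1)"
  define a where "a = r * b + 1"
  \<comment> \<open>\<open>D\<close> is chosen so that at most \<open>n / (2 * a)\<close> vertices
    are heavy when there are at most \<open>(b + 1) * n\<close> cliques. \<open>K\<close> is the
    threshold of \<open>ex_heavy_link\<close>, and \<open>M\<close> pays for the vertices adjacent
    to almost everything.\<close>
  define D where "D = 2 * a * (r * (b + 1))"
  define K where "K = D * 2 ^ (r * D) + 1"
  define M where "M = 2 * (s * K) * a"
  fix G :: "'a graph"
  assume "clique_saturated_graph G s" and nosplit: "\<not> (\<exists>Q. split_graph G Q \<and> card Q = s - 2)"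
  then interpret clique_saturated_graph G s by simp
  define n where "n = card (verts G)"
  define N where "N = card (cliques r G)"
  show "2 * r * ((s - 2) choose (r - 1)) * card (verts G) + card (verts G)
    \<le> 2 * r * card (cliques r G) + M"
  proof (cases "N \<le> (b + 1) * n")
    \<comment> \<open>With more than \<open>(b + 1) * n\<close> cliques the bound holds outright;
      the other case is what keeps heavy vertices rare.\<close>
    case False
    have "2 * r * b * n + n \<le> 2 * r * b * n + 2 * r * n" using r by simp
    also have "\<dots> = 2 * r * ((b + 1) * n)" by (simp add: algebra_simps)
    also have "\<dots> \<le> 2 * r * N" using False by (intro mult_left_mono) auto
    finally show ?thesis by (simp add: n_def N_def b_def)
  next
    case True
    define S where "S = {v \<in> verts G. D < card (through r v)}"
    define Z where "Z = {v \<in> verts G. card (verts G - nbrs G v) \<le> K}"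
    define T where "T = verts G - S - Z"
    have "card S * D = (\<Sum>v\<in>S. D)" by simp
    also have "\<dots> \<le> (\<Sum>v\<in>S. card (through r v))" by (rule sum_mono) (auto simp: S_def)
    also have "\<dots> \<le> (\<Sum>v\<in>verts G. card (through r v))"
      using finite_verts by (intro sum_mono2) (auto simp: S_def)
    also have "\<dots> = r * N" by (simp add: sum_card_through N_def)
    also have "\<dots> \<le> r * ((b + 1) * n)" using True by (rule mult_left_mono) simp
    finally have "(r * (b + 1)) * (2 * a * card S) \<le> (r * (b + 1)) * n"
      by (simp add: D_def algebra_simps)
    then have S: "2 * a * card S \<le> n" using r by (subst (asm) mult_le_cancel1) auto
    have Z: "card Z \<le> s * K" unfolding Z_def by (rule few_almost_conical) (simp add: K_def)
    have "card T * (r * ((s - 2) choose (r - 1)) + 1) \<le> r * card (cliques r G)"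
    proof (rule weighted_clique_count[OF r])
      show "T \<subseteq> verts G" "S \<inter> T = {}" by (auto simp: T_def)
      fix v assume v: "v \<in> T"
      have "\<exists>Q\<in>link v. \<forall>q\<in>Q. D < card (through r q)"
        using v r by (intro ex_heavy_link) (auto simp: T_def S_def Z_def K_def)
      then obtain Q where Q: "Q \<in> link v" "\<forall>q\<in>Q. D < card (through r q)" by blast
      moreover have "Q \<subseteq> S" using Q by (auto simp: S_def link_def cliques_def)
      moreover have "link v \<noteq> {Q}"
        using unique_link_imp_split[of v Q] nosplit v r by (auto simp: T_def)
      ultimately show "\<exists>Q\<in>link v. Q \<subseteq> S \<and> link v \<noteq> {Q}" by blast
    qed
    then have T: "card T * a \<le> r * N" by (simp add: a_def b_def N_def)
    have "n \<le> card (T \<union> S \<union> Z)"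
      unfolding n_def using finite_verts by (intro card_mono) (auto simp: T_def S_def Z_def)
    also have "\<dots> \<le> card T + card S + card Z"
      by (meson add_right_mono card_Un_le order_trans)
    finally have "2 * a * n \<le> 2 * a * (card T + card S + card Z)" by (rule mult_left_mono) simp
    also have "\<dots> = 2 * (card T * a) + 2 * a * card S + 2 * a * card Z" by (simp add: algebra_simps)
    \<comment> \<open>The left side is \<open>2 * r * b * n + 2 * n\<close>. Heavy vertices consume
      one \<open>n\<close>, and the other is the surplus that is claimed.\<close>
    also have "\<dots> \<le> 2 * (r * N) + n + 2 * a * (s * K)"
      using S T Z by (intro add_mono mult_left_mono) auto
    finally show ?thesis
      unfolding n_def[symmetric] N_def[symmetric] b_def[symmetric]
      by (simp add: a_def M_def algebra_simps)
  qed
qed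

section \<open>The extremal graph: isomorphism type, clique count, saturation\<close>

text \<open>Adjacency depends only on membership in the clique part, so any bijections between the
  two parts and between their complements combine to an isomorphism.\<close>

lemma graph_iso_split_graph:
  assumes "split_graph G Q" "split_graph H R" "finite (verts G)" "finite (verts H)"
    "card (verts G) = card (verts H)" "card Q = card R"
  shows "graph_iso G H"
proof -
  have Q: "Q \<subseteq> verts G" and R: "R \<subseteq> verts H" using assms by (auto simp: split_graph_def)
  have fin: "finite Q" "finite R" using Q R assms finite_subset by auto
  obtain f where f: "bij_betw f Q R"
    using finite_same_card_bij[OF fin] assms by blast
  have "card (verts G - Q) = card (verts H - R)"
    using assms fin Q R by (simp add: card_Diff_subset)
  then obtain g where g: "bij_betw g (verts G - Q) (verts H - R)"
    using finite_same_card_bij assms by blast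
  define h where "h x = (if x \<in> Q then f x else g x)" for x
  have "bij_betw h (Q \<union> (verts G - Q)) (R \<union> (verts H - R))"
    unfolding h_def using f g by (intro bij_betw_disjoint_Un) auto
  moreover have "Q \<union> (verts G - Q) = verts G" "R \<union> (verts H - R) = verts H" using Q R by auto
  ultimately have h: "bij_betw h (verts G) (verts H)" by simp
  have hR: "h x \<in> R \<longleftrightarrow> x \<in> Q" if "x \<in> verts G" for x
    using f g that by (auto simp: h_def bij_betw_def)
  have hV: "h x \<in> verts H" if "x \<in> verts G" for x
    using h that by (auto simp: bij_betw_def)
  have hinj: "h x = h y \<longleftrightarrow> x = y" if "x \<in> verts G" "y \<in> verts G" for x y
    using h that by (auto simp: bij_betw_def inj_on_def)
  show ?thesis
    unfolding graph_iso_def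
    using h hR hV hinj assms(1,2) by (intro exI[of _ h]) (simp add: split_graph_def)
qed

lemma split_graph_if_graph_iso:
  assumes "graph_iso G H" "split_graph H R"
  obtains Q where "split_graph G Q" "card Q = card R"
proof -
  obtain f where f: "bij_betw f (verts G) (verts H)"
    and e: "\<And>u v. u \<in> verts G \<Longrightarrow> v \<in> verts G \<Longrightarrow> {u, v} \<in> edges G \<longleftrightarrow> {f u, f v} \<in> edges H"
    using assms(1) by (auto simp: graph_iso_def)
  define Q where "Q = {x \<in> verts G. f x \<in> R}"
  have R: "R \<subseteq> verts H" using assms(2) by (simp add: split_graph_def)
  have "bij_betw f Q R"
    using f R by (auto simp: bij_betw_def Q_def inj_on_def)
  then have "card Q = card R" by (rule bij_betw_same_card)
  moreover have "split_graph G Q"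
    unfolding split_graph_def
  proof (intro conjI ballI)
    fix u v assume uv: "u \<in> verts G" "v \<in> verts G"
    then have "f u \<in> verts H" "f v \<in> verts H" "f u = f v \<longleftrightarrow> u = v"
      using f by (auto simp: bij_betw_def inj_on_def)
    then show "{u, v} \<in> edges G \<longleftrightarrow> u \<noteq> v \<and> (u \<in> Q \<or> v \<in> Q)"
      using assms(2) e[OF uv] uv by (simp add: split_graph_def Q_def)
  qed (simp add: Q_def)
  ultimately show ?thesis using that by blast
qed

lemma split_graph_join:
  "split_graph (graph_join (complete_graph k) (empty_graph m)) (Inl ` {..<k})"
  unfolding split_graph_def
proof (intro conjI ballI)
  let ?J = "graph_join (complete_graph k) (empty_graph m)"
  show "Inl ` {..<k} \<subseteq> verts ?J" by (auto simp: graph_join_def complete_graph_def)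
  have E: "edges ?J = (`) Inl ` {e. e \<subseteq> {..<k} \<and> card e = 2} \<union> {{Inl u, Inr v} | u v. u < k \<and> v < m}"
    by (auto simp: graph_join_def complete_graph_def empty_graph_def)
  have LL: "{Inl u, Inl v} \<in> edges ?J \<longleftrightarrow> u \<noteq> v \<and> u < k \<and> v < k" for u v
  proof
    assume "{Inl u, Inl v} \<in> edges ?J"
    then obtain e where e: "{Inl u, Inl v} = (Inl ` e :: (nat + nat) set)" "e \<subseteq> {..<k}" "card e = 2"
      unfolding E by (auto simp: doubleton_eq_iff)
    then have "Inl ` e = (Inl ` {u, v} :: (nat + nat) set)" by simp
    then have "e = {u, v}" by (subst (asm) inj_image_eq_iff) auto
    then show "u \<noteq> v \<and> u < k \<and> v < k" using e by (cases "u = v") auto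
  next
    assume "u \<noteq> v \<and> u < k \<and> v < k"
    then have "Inl ` {u, v} \<in> edges ?J" unfolding E by (intro UnI1 imageI) auto
    then show "{Inl u, Inl v} \<in> edges ?J" by simp
  qed
  have LR: "{Inl u, Inr v} \<in> edges ?J \<longleftrightarrow> u < k \<and> v < m" for u v
    unfolding E by (auto simp: doubleton_eq_iff)
  have RR: "{Inr u, Inr v} \<notin> edges ?J" for u v
    unfolding E by (auto simp: doubleton_eq_iff)
  fix x y assume "x \<in> verts ?J" "y \<in> verts ?J"
  then show "{x, y} \<in> edges ?J \<longleftrightarrow> x \<noteq> y \<and> (x \<in> Inl ` {..<k} \<or> y \<in> Inl ` {..<k})"
    using LL LR RR insert_commute[of x y "{}"]
    by (cases x; cases y) (auto simp: graph_join_def complete_graph_def empty_graph_def)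
qed

text \<open>Replaces the isomorphism in the theorem, which passes to a sum type, by a property of
  \<open>G\<close> itself.\<close>

lemma graph_iso_join_iff_split_graph:
  assumes "simple_graph G" "card (verts G) = k + m"
  shows "graph_iso G (graph_join (complete_graph k) (empty_graph m))
    \<longleftrightarrow> (\<exists>Q. split_graph G Q \<and> card Q = k)"
proof -
  let ?J = "graph_join (complete_graph k) (empty_graph m)"
  have J: "verts ?J = {..<k} <+> {..<m}" by (simp add: graph_join_def complete_graph_def empty_graph_def)
  have "card (Inl ` {..<k} :: (nat + nat) set) = k" by (simp add: card_image)
  moreover have "finite (verts G)" using assms by (simp add: simple_graph_def)
  ultimately show ?thesis
    using graph_iso_split_graph[OF _ split_graph_join, of G _ k m]
      split_graph_if_graph_iso[OF _ split_graph_join, of G k m] assms J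
    by (metis card_Plus card_lessThan finite_Plus finite_lessThan)
qed

text \<open>The vertices outside \<open>Q\<close> are independent, so a clique has at most one of
  them.\<close>

lemma cliques_split_graph:
  assumes G: "simple_graph G" and sp: "split_graph G Q" and r: "1 \<le> r"
  shows "cliques r G = {X. X \<subseteq> Q \<and> card X = r} \<union>
    (\<lambda>(w, R). insert w R) ` ((verts G - Q) \<times> {R. R \<subseteq> Q \<and> card R = r - 1})" (is "_ = ?A \<union> ?B")
proof
  have QV: "Q \<subseteq> verts G" using sp by (simp add: split_graph_def)
  have finQ: "finite Q" using QV G finite_subset by (auto simp: simple_graph_def)
  show "cliques r G \<subseteq> ?A \<union> ?B"
  proof
    fix X assume X: "X \<in> cliques r G"
    show "X \<in> ?A \<union> ?B"
    proof (cases "X \<subseteq> Q")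
      case True
      then show ?thesis using X by (simp add: cliques_def)
    next
      case False
      then obtain w where w: "w \<in> X" "w \<notin> Q" by blast
      have wV: "w \<in> verts G" using X w by (auto simp: cliques_def)
      have "X - {w} \<subseteq> Q"
        using X w sp by (fastforce simp: cliques_def split_graph_def)
      moreover have "card (X - {w}) = r - 1" using X w by (simp add: cliques_def)
      moreover have "X = insert w (X - {w})" using w by blast
      ultimately show ?thesis using w wV by blast
    qed
  qed
  show "?A \<union> ?B \<subseteq> cliques r G"
  proof
    fix X assume "X \<in> ?A \<union> ?B"
    then show "X \<in> cliques r G"
    proof
      assume "X \<in> ?A"
      then show ?thesis using QV sp by (auto simp: cliques_def split_graph_def subset_eq)
    next
      assume "X \<in> ?B"
      then obtain w R where X: "X = insert w R" "w \<in> verts G" "w \<notin> Q" "R \<subseteq> Q" "card R = r - 1" by auto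
      then have "finite R" "w \<notin> R" using finQ finite_subset by blast+
      then have "card X = r" using X r by simp
      then show ?thesis using X QV sp by (auto simp: cliques_def split_graph_def subset_eq)
    qed
  qed
qed

lemma card_cliques_split_graph:
  assumes G: "simple_graph G" and sp: "split_graph G Q" and r: "1 \<le> r"
  shows "card (cliques r G) =
    (card (verts G) - card Q) * (card Q choose (r - 1)) + (card Q choose r)"
proof -
  have QV: "Q \<subseteq> verts G" using sp by (simp add: split_graph_def)
  have finV: "finite (verts G)" using G by (simp add: simple_graph_def)
  have finQ: "finite Q" using QV finV finite_subset by blast
  let ?A = "{X. X \<subseteq> Q \<and> card X = r}"
  let ?P = "(verts G - Q) \<times> {R. R \<subseteq> Q \<and> card R = r - 1}"
  let ?f = "\<lambda>(w, R). insert w R"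
  have "inj_on ?f ?P"
  proof (rule inj_onI, clarify)
    fix w R w' R'
    assume *: "insert w R = insert w' R'" "w \<notin> Q" "w' \<notin> Q" "R \<subseteq> Q" "R' \<subseteq> Q"
    \<comment> \<open>Intersecting with \<open>Q\<close> recovers \<open>R\<close>, and what is left
      over is \<open>w\<close>.\<close>
    then have "R = insert w R \<inter> Q" "R' = insert w' R' \<inter> Q" by auto
    then have "R = R'" using * by simp
    moreover have "w = w'" using * by blast
    ultimately show "w = w' \<and> R = R'" by simp
  qed
  then have "card (?f ` ?P) = card ?P" by (rule card_image)
  also have "\<dots> = (card (verts G) - card Q) * (card Q choose (r - 1))"
    using n_subsets[OF finQ, of "r - 1"] QV finQ by (simp add: card_cartesian_product card_Diff_subset)
  finally have B: "card (?f ` ?P) = \<dots>" .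
  have "card (?A \<union> ?f ` ?P) = card ?A + card (?f ` ?P)"
    using finQ finV by (intro card_Un_disjoint) auto
  then show ?thesis using B n_subsets[OF finQ, of r] cliques_split_graph[OF assms] by simp
qed

text \<open>For cliques of size \<open>s\<close> both binomials in the count vanish. Non-adjacent
  vertices lie outside \<open>Q\<close>, which is then their common clique.\<close>

lemma split_graph_saturated:
  assumes G: "simple_graph G" and sp: "split_graph G Q" and s: "2 \<le> s" and Q: "card Q = s - 2"
  shows "saturated (complete_graph s) G"
proof -
  have QV: "Q \<subseteq> verts G" using sp by (simp add: split_graph_def)
  have "card (cliques s G) = 0"
    using card_cliques_split_graph[OF G sp, of s] s Q by (simp add: binomial_eq_0)
  then have free: "cliques s G = {}" using finite_cliques[OF G] by simp
  have Qc: "Q \<in> cliques (s - 2) G" using Q QV sp by (auto simp: cliques_def split_graph_def subset_eq)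
  have "clique_saturated_graph G s"
  proof (unfold_locales)
    fix u v assume "u \<in> verts G" "v \<in> verts G" "u \<noteq> v" "{u, v} \<notin> edges G"
    then have "Q \<subseteq> nbrs G u \<inter> nbrs G v"
      using sp by (auto simp: nbrs_def split_graph_def)
    then show "\<exists>P\<in>cliques (s - 2) G. P \<subseteq> nbrs G u \<inter> nbrs G v" using Qc by blast
  qed (fact G free)+
  then show ?thesis using saturated_complete_graph_iff[OF G s] by simp
qed

section \<open>The minimum and its uniqueness\<close>

text \<open>\<open>sat\<close> minimises over graphs on natural numbers, whereas the join has
  vertices in a sum type; this provides an extremal graph of the right type.\<close>

lemma ex_split_graph:
  assumes "k \<le> n"
  obtains G :: "nat graph" and Q where "simple_graph G" "card (verts G) = n" "split_graph G Q" "card Q = k"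
proof
  let ?G = "({..<n}, {{u, v} | u v. u < k \<and> v < n \<and> u \<noteq> v})"
  show "simple_graph ?G" using assms by (auto simp: simple_graph_def)
  show "split_graph ?G {..<k}"
    using assms by (auto simp: split_graph_def doubleton_eq_iff)
qed simp_all

theorem theorem1p3:
  fixes r s :: nat
  assumes "2 \<le> r" and "r < s"
  shows "\<exists>n\<^sub>0 :: nat.
    (\<forall>n\<ge>n\<^sub>0. sat n (complete_graph r) (complete_graph s) =
        (n + 2 - s) * ((s - 2) choose (r - 1)) + ((s - 2) choose r)) \<and>
    (\<exists>c :: real. c > 0 \<and>
      (\<forall>n\<ge>n\<^sub>0. \<forall>G :: nat graph. simple_graph G \<and> card (verts G) = n \<longrightarrow>
        (saturated (complete_graph s) G \<and>
         real (card (copies (complete_graph r) G))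
           \<le> real (sat n (complete_graph r) (complete_graph s)) + c * real n
         \<longleftrightarrow> graph_iso G (graph_join (complete_graph (s - 2)) (empty_graph (n + 2 - s))))))"
proof -
  define b where "b = (s - 2) choose (r - 1)"
  define b' where "b' = (s - 2) choose r"
  define f where "f n = (n + 2 - s) * b + b'" for n
  define splits where "splits G \<longleftrightarrow> (\<exists>Q. split_graph G Q \<and> card Q = s - 2)" for G :: "nat graph"
  obtain M where M: "\<And>G :: nat graph. clique_saturated_graph G s \<Longrightarrow> \<not> splits G \<Longrightarrow>
    2 * r * b * card (verts G) + card (verts G) \<le> 2 * r * card (cliques r G) + M"
    using many_cliques_unless_split[OF assms, where 'a = nat] unfolding b_def splits_def by metis
  \<comment> \<open>A non-split saturated graph with at most \<open>f n + c * n\<close> cliques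
    would have \<open>n \<le> 4 * r * b' + 2 * M\<close>, which \<open>n\<^sub>0\<close> exceeds.
    The summand \<open>s\<close> leaves room for \<open>s - 2\<close> clique vertices.\<close>
  define n\<^sub>0 where "n\<^sub>0 = 4 * r * b' + 2 * M + s + 1"
  \<comment> \<open>Half of the surplus \<open>1 / (2 * r)\<close> per vertex; the other half
    absorbs the constants \<open>b'\<close> and \<open>M\<close> for large \<open>n\<close>.\<close>
  define c :: real where "c = 1 / (4 * real r)"
  have r0: "0 < real r" using assms by simp
  have s2: "2 \<le> s" using assms by simp
  have c: "c > 0" using r0 by (simp add: c_def)
  have split: "saturated (complete_graph s) G \<and> card (copies (complete_graph r) G) = f n"
    if G: "simple_graph G" "card (verts G) = n" "splits G" for n and G :: "nat graph"
  proof -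
    obtain Q where Q: "split_graph G Q" "card Q = s - 2" using G(3) by (auto simp: splits_def)
    have "n - (s - 2) = n + 2 - s" using s2 by simp
    then show ?thesis
      using split_graph_saturated[OF G(1) Q(1) s2 Q(2)] card_cliques_split_graph[OF G(1) Q(1), of r]
        card_copies_complete_graph[OF G(1), of r] Q(2) G(2) assms
      by (simp add: f_def b_def b'_def)
  qed
  have nonsplit: "real (card (copies (complete_graph r) G)) > real (f n) + c * real n"
    if G: "simple_graph G" "card (verts G) = n" "saturated (complete_graph s) G" "\<not> splits G"
      and n: "n \<ge> n\<^sub>0" for n and G :: "nat graph"
  proof (rule ccontr)
    let ?N = "card (copies (complete_graph r) G)"
    assume "\<not> ?thesis"
    then have "2 * real r * ?N \<le> 2 * real r * (real (f n) + c * real n)"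
      using r0 by (intro mult_left_mono) auto
    also have "\<dots> = 2 * real r * real (f n) + real n / 2"
      using r0 by (simp add: c_def field_simps)
    also have "real (f n) \<le> real (n * b + b')"
      unfolding f_def using s2 by (intro of_nat_mono add_right_mono mult_right_mono) auto
    finally have "2 * real r * ?N \<le> 2 * real r * (real n * b + b') + real n / 2"
      using r0 by simp
    moreover have "real (2 * r * b * n + n) \<le> real (2 * r * ?N + M)"
      using M[of G] G saturated_complete_graph_iff[OF G(1) s2] card_copies_complete_graph[OF G(1), of r]
      by (intro of_nat_mono) simp
    ultimately have "real n \<le> 4 * real r * b' + 2 * real M" by (simp add: algebra_simps)
    moreover have "real n \<ge> real (4 * r * b' + 2 * M + s + 1)" using n by (simp only: n\<^sub>0_def of_nat_mono)
    ultimately show False by simp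
  qed
  have sat: "sat n (complete_graph r) (complete_graph s) = f n" if n: "n \<ge> n\<^sub>0" for n
  proof -
    let ?C = "{card (copies (complete_graph r) G) | G :: nat graph.
      simple_graph G \<and> card (verts G) = n \<and> saturated (complete_graph s) G}"
    have "s - 2 \<le> n" using n by (simp add: n\<^sub>0_def)
    then obtain G :: "nat graph" and Q where
      "simple_graph G" "card (verts G) = n" "split_graph G Q" "card Q = s - 2"
      using ex_split_graph by blast
    then have "simple_graph G \<and> card (verts G) = n \<and> saturated (complete_graph s) G"
      "f n = card (copies (complete_graph r) G)"
      using split[of G n] unfolding splits_def by metis+
    then have "f n \<in> ?C" by blast
    \<comment> \<open>Split graphs have exactly \<open>f n\<close> cliques, and all other saturated
      graphs have more by \<open>nonsplit\<close>.\<close>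
    moreover have "f n \<le> x" if "x \<in> ?C" for x
    proof -
      obtain G :: "nat graph" where G: "simple_graph G" "card (verts G) = n"
        "saturated (complete_graph s) G" "x = card (copies (complete_graph r) G)"
        using \<open>x \<in> ?C\<close> by blast
      have "0 \<le> c * real n" using c by simp
      then have "real (f n) \<le> real x"
        using split[OF G(1,2)] nonsplit[OF G(1-3) _ n] G(4) by fastforce
      then show ?thesis by simp
    qed
    ultimately show ?thesis unfolding sat_def by (rule cInf_eq_minimum)
  qed
  have "saturated (complete_graph s) G \<and> real (card (copies (complete_graph r) G)) \<le>
      real (sat n (complete_graph r) (complete_graph s)) + c * real n \<longleftrightarrow>
    graph_iso G (graph_join (complete_graph (s - 2)) (empty_graph (n + 2 - s)))"
    if "n \<ge> n\<^sub>0" "simple_graph G" "card (verts G) = n" for n and G :: "nat graph"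
  proof -
    have "card (verts G) = (s - 2) + (n + 2 - s)" using that s2 by (simp add: n\<^sub>0_def)
    then have "graph_iso G (graph_join (complete_graph (s - 2)) (empty_graph (n + 2 - s))) \<longleftrightarrow> splits G"
      unfolding splits_def by (rule graph_iso_join_iff_split_graph[OF that(2)])
    moreover have "0 \<le> c * real n" using c by simp
    ultimately show ?thesis
      using split[OF that(2,3)] nonsplit[OF that(2,3) _ _ that(1)] sat[OF that(1)] by fastforce
  qed
  then show ?thesis using sat c unfolding f_def b_def b'_def by blast
qed

end
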